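(* For $n\ge0$ let $p_n$ be the number of polydiagonal subspaces of $\mathbb{R}^n$. The exponential generating function of $(p_n)$ is $$P(x)=\sum_{n=0}^\infty p_n\frac{x^n}{n!}=e^{(e^{2x}-1+2x)/2}.$$
   Context: A partial involution on a set $X$ is a map $x\mapsto x^*:\tilde X\to\tilde X$ defined on a (possibly empty) subset $\tilde X\subseteq X$ that is its own inverse. A tagged partition of a finite set $C$ is a partition $\mathcal{P}$ of $C$ (into nonempty classes) together with a partial involution $P\mapsto P^*$ on $\mathcal{P}$ that has at most one fixed point. The class of $i$ is denoted by $[i]$. For a tagged partition $\mathcal{P}$ of $\{1,\ldots,n\}$, the polydiagonal subspace is $$\Delta_{\mathcal{P}}=\{x\in\mathbb{R}^n\mid x_i=x_j\text{ if }[i]=[j],\text{ and }x_i=-x_j\text{ if }[i]^*=[j]\};$$ a subspace of $\mathbb{R}^n$ is a polydiagonal subspace if it equals $\Delta_{\mathcal{P}}$ for some tagged partition $\mathcal{P}$ of $\{1,\ldots,n\}$. The map $\mathcal{P}\mapsto\Delta_{\mathcal{P}}$ is a bijection from tagged partitions of $\{1,\ldots,n\}$ to polydiagonal subspaces of $\mathbb{R}^n$. For $n=0$ the only tagged partition is the empty one (with empty partial involution). Exponential generating functions are formal power series. *)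

theory Defs
  imports
    Complex_Main
    "HOL-Library.FuncSet"
    "HOL-Library.Disjoint_Sets"
    "HOL-Computational_Algebra.Formal_Power_Series"
begin

text \<open>A partial involution is encoded as a partial map \<open>s\<close>, with \<open>x\<^sup>* = y\<close> written
  \<open>s x = Some y\<close>. The second clause says both that \<open>s\<close> maps its domain into itself and that it
  is its own inverse.\<close>

definition partial_involution :: "'a set \<Rightarrow> ('a \<rightharpoonup> 'a) \<Rightarrow> bool" where
  "partial_involution X s \<longleftrightarrow>
     dom s \<subseteq> X \<and> (\<forall>x y. s x = Some y \<longrightarrow> s y = Some x)"

definition tagged_partition :: "'a set \<Rightarrow> 'a set set \<Rightarrow> ('a set \<rightharpoonup> 'a set) \<Rightarrow> bool" where
  "tagged_partition C \<P> s \<longleftrightarrow>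
     finite C \<and> partition_on C \<P> \<and> partial_involution \<P> s \<and>
     (\<forall>P Q. s P = Some P \<and> s Q = Some Q \<longrightarrow> P = Q)"

definition class_of :: "'a set set \<Rightarrow> 'a \<Rightarrow> 'a set" where
  "class_of \<P> i = (THE P. P \<in> \<P> \<and> i \<in> P)"

text \<open>Since the dimension \<open>n\<close> varies and may be \<open>0\<close>, vectors in \<open>\<real>\<^sup>n\<close> are the extensional
  functions in \<open>{1..n} \<rightarrow>\<^sub>E UNIV\<close>: they have a fixed dummy value outside \<open>{1..n}\<close>, so that
  each vector is represented exactly once.\<close>

definition polydiagonal ::
    "nat \<Rightarrow> nat set set \<Rightarrow> (nat set \<rightharpoonup> nat set) \<Rightarrow> (nat \<Rightarrow> real) set" where
  "polydiagonal n \<P> s =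
     {x \<in> {1..n} \<rightarrow>\<^sub>E UNIV. \<forall>i\<in>{1..n}. \<forall>j\<in>{1..n}.
        (class_of \<P> i = class_of \<P> j \<longrightarrow> x i = x j) \<and>
        (s (class_of \<P> i) = Some (class_of \<P> j) \<longrightarrow> x i = - x j)}"

definition polydiagonal_subspace :: "nat \<Rightarrow> (nat \<Rightarrow> real) set \<Rightarrow> bool" where
  "polydiagonal_subspace n V \<longleftrightarrow>
     (\<exists>\<P> s. tagged_partition {1..n} \<P> s \<and> V = polydiagonal n \<P> s)"

definition num_polydiagonal_subspaces :: "nat \<Rightarrow> nat" where
  "num_polydiagonal_subspaces n = card {V. polydiagonal_subspace n V}"

end

theory Submission imports Defs begin

text \<open>A polydiagonal subspace is the solution set of an arbitrary system of constraints
  \<open>x\<^sub>i = x\<^sub>j\<close> and \<open>x\<^sub>i = - x\<^sub>j\<close>: the tagged partition is read off from all constraints that the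
  solution set implies. In this form the subspaces can be counted by looking at one coordinate \<open>a\<close>.
  Either \<open>x\<^sub>a\<close> vanishes identically, and the rest is a subspace on the other coordinates, or
  there are a set \<open>B\<close> of coordinates equal to \<open>\<plusminus> x\<^sub>a\<close>, a choice of signs on \<open>B\<close>, and a subspace
  on the coordinates outside \<open>B\<close>. Hence \<open>P' = (1 + e\<^sup>2\<^sup>x) P\<close>, which together with \<open>P(0) = 1\<close>
  determines \<open>P\<close>.\<close>

section \<open>Solution sets of signed equality constraints\<close>

definition signed_solutions :: "'a set \<Rightarrow> ('a \<times> 'a) set \<Rightarrow> ('a \<times> 'a) set \<Rightarrow> ('a \<Rightarrow> real) set" where
  "signed_solutions A E F =
     {x \<in> A \<rightarrow>\<^sub>E UNIV. \<forall>i\<in>A. \<forall>j\<in>A.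
        ((i, j) \<in> E \<longrightarrow> x i = x j) \<and> ((i, j) \<in> F \<longrightarrow> x i = - x j)}"

text \<open>The index set is arbitrary because the recursion passes to subsets of it.
  \<open>E\<close> and \<open>F\<close> may be any relations, neither symmetric nor transitively
  closed; only their pairs inside \<open>A\<close> have an effect.\<close>

definition signed_spaces :: "'a set \<Rightarrow> ('a \<Rightarrow> real) set set" where
  "signed_spaces A = {V. \<exists>E F. V = signed_solutions A E F}"

text \<open>Pairs are not confined to an index set: extensional vectors agree at all outside
  indices, so pairs of such indices belong to this relation too. Later arguments cut down to the
  index set where this matters.\<close>

definition implied_eq :: "('a \<Rightarrow> real) set \<Rightarrow> ('a \<times> 'a) set" where
  "implied_eq V = {(i, j). \<forall>x\<in>V. x i = x j}"

definition implied_neg :: "('a \<Rightarrow> real) set \<Rightarrow> ('a \<times> 'a) set" where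
  "implied_neg V = {(i, j). \<forall>x\<in>V. x i = - x j}"

text \<open>Closure argument: \<open>V\<close> satisfies every constraint that it implies, and
  inside \<open>A\<close> the implied constraints include the defining ones, so passing to all of
  them does not shrink or enlarge the solution set.\<close>

lemma signed_spaces_implied:
  assumes "V \<in> signed_spaces A"
  shows "V = signed_solutions A (implied_eq V) (implied_neg V)"
proof -
  obtain E F where "V = signed_solutions A E F"
    using assms unfolding signed_spaces_def by blast
  then show ?thesis
    unfolding signed_solutions_def implied_eq_def implied_neg_def by (intro equalityI) blast+
qed

lemma signed_spaces_extensional: "V \<in> signed_spaces A \<Longrightarrow> x \<in> V \<Longrightarrow> x \<in> A \<rightarrow>\<^sub>E UNIV"
  unfolding signed_spaces_def signed_solutions_def by blast

lemma restrict_in_signed_solutions: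
  "restrict x A \<in> signed_solutions A E F \<longleftrightarrow>
     (\<forall>i\<in>A. \<forall>j\<in>A. ((i, j) \<in> E \<longrightarrow> x i = x j) \<and> ((i, j) \<in> F \<longrightarrow> x i = - x j))"
  by (simp add: signed_solutions_def)

lemma zero_in_signed_spaces: "V \<in> signed_spaces A \<Longrightarrow> (\<lambda>i\<in>A. 0) \<in> V"
  unfolding signed_spaces_def signed_solutions_def by auto

lemma signed_spaces_empty: "signed_spaces {} = {{\<lambda>_. undefined}}"
  unfolding signed_spaces_def signed_solutions_def by auto

section \<open>Tagged partitions read off from implied constraints\<close>

lemma class_of_partition_on:
  assumes "partition_on A \<P>" "P \<in> \<P>" "i \<in> P"
  shows "class_of \<P> i = P"
  unfolding class_of_def
  using assms by (intro the_equality) (auto simp: partition_on_def disjoint_def)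

text \<open>The classes are those of implied equality on \<open>A\<close>, and the partner of a
  class consists of the coordinates that are always its negative.\<close>

lemma tagged_partition_of_signed_space:
  assumes fin: "finite A" and V: "V \<in> signed_spaces A"
  obtains \<P> s where "tagged_partition A \<P> s"
    and "\<And>i j. i \<in> A \<Longrightarrow> j \<in> A \<Longrightarrow> class_of \<P> i = class_of \<P> j \<longleftrightarrow> (i, j) \<in> implied_eq V"
    and "\<And>i j. i \<in> A \<Longrightarrow> j \<in> A \<Longrightarrow>
           s (class_of \<P> i) = Some (class_of \<P> j) \<longleftrightarrow> (i, j) \<in> implied_neg V"
proof -
  define r where "r = implied_eq V \<inter> A \<times> A"
  define cl where "cl i = r `` {i}" for i
  define neg where "neg Q = {j \<in> A. \<forall>i\<in>Q. (i, j) \<in> implied_neg V}" for Q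
  \<comment> \<open>An empty \<open>neg Q\<close> means that no coordinate is the negative of those
    in \<open>Q\<close>; such a class stays outside the domain of the involution.\<close>
  define s where "s Q = (if Q \<in> A // r \<and> neg Q \<noteq> {} then Some (neg Q) else None)" for Q
  have r: "equiv A r"
    by (rule equivI) (auto simp: r_def implied_eq_def refl_on_def sym_def trans_def)
  have part: "partition_on A (A // r)"
    using r by (rule partition_on_quotient)
  have cl_in: "cl i \<in> A // r" if "i \<in> A" for i
    using that by (auto simp: cl_def quotient_def)
  have cl_self: "i \<in> cl i" if "i \<in> A" for i
    using that r by (auto simp: cl_def equiv_def refl_on_def)
  have class_cl: "class_of (A // r) i = cl i" if "i \<in> A" for i
    using class_of_partition_on[OF part cl_in cl_self] that by blast
  have cl_eq: "cl i = cl j \<longleftrightarrow> (i, j) \<in> implied_eq V" if "i \<in> A" "j \<in> A" for i j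
    using eq_equiv_class_iff[OF r that] that by (auto simp: cl_def r_def)
  have neg_cl: "neg (cl i) = {j \<in> A. (i, j) \<in> implied_neg V}" if "i \<in> A" for i
    using that by (auto simp: neg_def cl_def r_def implied_eq_def implied_neg_def)
  \<comment> \<open>Two coordinates that are both the negative of coordinate \<open>i\<close> are
    equal to each other, so a nonempty \<open>neg (cl i)\<close> is a full class.\<close>
  have neg_cl_eq: "neg (cl i) = cl j" if "i \<in> A" "j \<in> A" "(i, j) \<in> implied_neg V" for i j
    using that unfolding neg_cl[OF that(1)]
    by (force simp: cl_def r_def implied_eq_def implied_neg_def)
  have s_cl: "s (cl i) = Some (cl j) \<longleftrightarrow> (i, j) \<in> implied_neg V" if ij: "i \<in> A" "j \<in> A" for i j
  proof
    assume "s (cl i) = Some (cl j)"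
    then have "neg (cl i) = cl j" by (auto simp: s_def split: if_splits)
    then show "(i, j) \<in> implied_neg V" using cl_self[OF ij(2)] neg_cl[OF ij(1)] by auto
  next
    assume "(i, j) \<in> implied_neg V"
    then show "s (cl i) = Some (cl j)"
      using neg_cl_eq[OF ij] cl_self[OF ij(2)] cl_in[OF ij(1)] by (auto simp: s_def)
  qed
  have s_SomeE: "\<exists>i\<in>A. \<exists>j\<in>A. Q = cl i \<and> R = cl j \<and> (i, j) \<in> implied_neg V"
    if "s Q = Some R" for Q R
  proof -
    have *: "Q \<in> A // r" "neg Q \<noteq> {}" "R = neg Q"
      using that by (auto simp: s_def split: if_splits)
    from *(1) obtain i where i: "i \<in> A" "Q = cl i" by (auto simp: quotient_def cl_def)
    with * obtain j where j: "j \<in> A" "(i, j) \<in> implied_neg V" using neg_cl[OF i(1)] by auto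
    show ?thesis using * i j neg_cl_eq by blast
  qed
  have neg_sym: "(j, i) \<in> implied_neg V" if "(i, j) \<in> implied_neg V" for i j
    using that by (auto simp: implied_neg_def)
  have "partial_involution (A // r) s"
    unfolding partial_involution_def
  proof (intro conjI allI impI)
    show "dom s \<subseteq> A // r" by (auto simp: s_def split: if_splits)
    show "s R = Some Q" if "s Q = Some R" for Q R
      using s_SomeE[OF that] s_cl neg_sym by blast
  qed
  \<comment> \<open>A class that is its own partner satisfies \<open>x i = - x i\<close>, so its
    coordinates vanish on \<open>V\<close>. All vanishing coordinates are equal and hence share one
    class.\<close>
  moreover have "Q = R" if QR: "s Q = Some Q" "s R = Some R" for Q R
  proof -
    obtain i where i: "i \<in> A" "Q = cl i" using s_SomeE[OF QR(1)] by blast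
    obtain j where j: "j \<in> A" "R = cl j" using s_SomeE[OF QR(2)] by blast
    have "(i, i) \<in> implied_neg V" "(j, j) \<in> implied_neg V"
      using s_cl i j QR by auto
    then have "(i, j) \<in> implied_eq V" by (auto simp: implied_neg_def implied_eq_def)
    then show ?thesis using cl_eq i j by blast
  qed
  ultimately have "tagged_partition A (A // r) s"
    using fin part unfolding tagged_partition_def by blast
  then show ?thesis
    using that class_cl cl_eq s_cl by simp
qed

text \<open>One direction takes the conditions given by a tagged partition as the constraints. For
  the other, the tagged partition of \<open>V\<close> encodes exactly the implied constraints, whose
  solution set is \<open>V\<close> again.\<close>

lemma polydiagonal_subspace_iff: "polydiagonal_subspace n V \<longleftrightarrow> V \<in> signed_spaces {1..n}"
proof
  assume "polydiagonal_subspace n V"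
  then obtain \<P> s where V: "V = polydiagonal n \<P> s"
    unfolding polydiagonal_subspace_def by blast
  have "V = signed_solutions {1..n} {(i, j). class_of \<P> i = class_of \<P> j}
      {(i, j). s (class_of \<P> i) = Some (class_of \<P> j)}"
    unfolding V polydiagonal_def signed_solutions_def by simp
  then show "V \<in> signed_spaces {1..n}" unfolding signed_spaces_def by blast
next
  assume V: "V \<in> signed_spaces {1..n}"
  obtain \<P> s where *: "tagged_partition {1..n} \<P> s"
    "\<And>i j. i \<in> {1..n} \<Longrightarrow> j \<in> {1..n} \<Longrightarrow> class_of \<P> i = class_of \<P> j \<longleftrightarrow> (i, j) \<in> implied_eq V"
    "\<And>i j. i \<in> {1..n} \<Longrightarrow> j \<in> {1..n} \<Longrightarrow>
       s (class_of \<P> i) = Some (class_of \<P> j) \<longleftrightarrow> (i, j) \<in> implied_neg V"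
    using tagged_partition_of_signed_space[OF _ V] by blast
  have "polydiagonal n \<P> s = signed_solutions {1..n} (implied_eq V) (implied_neg V)"
    unfolding polydiagonal_def signed_solutions_def by (simp add: *(2,3))
  then show "polydiagonal_subspace n V"
    unfolding polydiagonal_subspace_def using *(1) signed_spaces_implied[OF V] by metis
qed

section \<open>Gluing a new coordinate onto a smaller space\<close>

definition glue_zero :: "'a \<Rightarrow> 'a set \<Rightarrow> ('a \<Rightarrow> real) set \<Rightarrow> ('a \<Rightarrow> real) set" where
  "glue_zero a A W = {x \<in> insert a A \<rightarrow>\<^sub>E UNIV. x a = 0 \<and> restrict x A \<in> W}"

text \<open>\<open>B\<close> collects the coordinates tied to that of \<open>a\<close>, and the
  choice of signs is recorded as the subset \<open>P\<close> where the sign is plus. Letting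
  \<open>P\<close> range over \<open>Pow B\<close> produces the factor \<open>2 ^ card B\<close> in
  the count.\<close>

definition glue_signed ::
    "'a \<Rightarrow> 'a set \<Rightarrow> 'a set \<Rightarrow> 'a set \<Rightarrow> ('a \<Rightarrow> real) set \<Rightarrow> ('a \<Rightarrow> real) set" where
  "glue_signed a A B P W =
     {x \<in> insert a A \<rightarrow>\<^sub>E UNIV. (\<forall>i\<in>P. x i = x a) \<and> (\<forall>i\<in>B - P. x i = - x a) \<and>
        restrict x (A - B) \<in> W}"

lemma glue_zero_in_signed_spaces:
  assumes "W \<in> signed_spaces A"
  shows "glue_zero a A W \<in> signed_spaces (insert a A)"
proof -
  obtain E F where W: "W = signed_solutions A E F"
    using assms unfolding signed_spaces_def by blast
  \<comment> \<open>The pair \<open>(a, a)\<close> in the negative relation says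
    \<open>x a = - x a\<close>, that is, \<open>x a = 0\<close>. Intersecting with
    \<open>A \<times> A\<close> discards pairs involving \<open>a\<close>, which had no effect on
    \<open>W\<close> but would act on the larger index set.\<close>
  have "glue_zero a A W =
      signed_solutions (insert a A) (E \<inter> A \<times> A) (F \<inter> A \<times> A \<union> {(a, a)})"
    unfolding glue_zero_def signed_solutions_def W by auto
  then show ?thesis unfolding signed_spaces_def by blast
qed

lemma glue_signed_in_signed_spaces:
  assumes "B \<subseteq> A" "P \<subseteq> B" "W \<in> signed_spaces (A - B)"
  shows "glue_signed a A B P W \<in> signed_spaces (insert a A)"
proof -
  obtain E F where W: "W = signed_solutions (A - B) E F"
    using assms(3) unfolding signed_spaces_def by blast
  let ?E = "E \<inter> (A - B) \<times> (A - B) \<union> P \<times> {a}"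
  let ?F = "F \<inter> (A - B) \<times> (A - B) \<union> (B - P) \<times> {a}"
  have W_iff: "restrict x (A - B) \<in> W \<longleftrightarrow>
      (\<forall>i\<in>A - B. \<forall>j\<in>A - B. ((i, j) \<in> E \<longrightarrow> x i = x j) \<and> ((i, j) \<in> F \<longrightarrow> x i = - x j))" for x
    unfolding W by (rule restrict_in_signed_solutions)
  have "glue_signed a A B P W = signed_solutions (insert a A) ?E ?F"
  proof
    show "glue_signed a A B P W \<subseteq> signed_solutions (insert a A) ?E ?F"
    proof
      fix x assume "x \<in> glue_signed a A B P W"
      then have x: "x \<in> insert a A \<rightarrow>\<^sub>E UNIV" "\<And>i. i \<in> P \<Longrightarrow> x i = x a"
        "\<And>i. i \<in> B - P \<Longrightarrow> x i = - x a" and W: "restrict x (A - B) \<in> W"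
        unfolding glue_signed_def by blast+
      have "x i = x j" if "(i, j) \<in> ?E" for i j
        using that x(2) W unfolding W_iff by (elim UnE) blast+
      moreover have "x i = - x j" if "(i, j) \<in> ?F" for i j
        using that x(3) W unfolding W_iff by (elim UnE) blast+
      ultimately show "x \<in> signed_solutions (insert a A) ?E ?F"
        using x(1) unfolding signed_solutions_def by blast
    qed
    show "signed_solutions (insert a A) ?E ?F \<subseteq> glue_signed a A B P W"
    proof
      fix x assume "x \<in> signed_solutions (insert a A) ?E ?F"
      then have x: "x \<in> insert a A \<rightarrow>\<^sub>E UNIV"
        and E: "\<And>i j. i \<in> insert a A \<Longrightarrow> j \<in> insert a A \<Longrightarrow> (i, j) \<in> ?E \<Longrightarrow> x i = x j"
        and F: "\<And>i j. i \<in> insert a A \<Longrightarrow> j \<in> insert a A \<Longrightarrow> (i, j) \<in> ?F \<Longrightarrow> x i = - x j"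
        unfolding signed_solutions_def by blast+
      have "x i = x a" if "i \<in> P" for i using E[of i a] that assms(1,2) by blast
      moreover have "x i = - x a" if "i \<in> B - P" for i using F[of i a] that assms(1) by blast
      moreover have "restrict x (A - B) \<in> W" unfolding W_iff using E F by blast
      ultimately show "x \<in> glue_signed a A B P W" using x by (simp add: glue_signed_def)
    qed
  qed
  then show ?thesis unfolding signed_spaces_def by blast
qed

lemma restrict_glue_zero:
  assumes "a \<notin> A" "W \<in> signed_spaces A"
  shows "(\<lambda>x. restrict x A) ` glue_zero a A W = W"
proof
  show "W \<subseteq> (\<lambda>x. restrict x A) ` glue_zero a A W"
  proof
    fix w assume w: "w \<in> W"
    have "restrict (w(a := 0)) A = w"
      using signed_spaces_extensional[OF assms(2) w] assms(1)
      by (auto simp: PiE_def extensional_def fun_eq_iff)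
    moreover have "w(a := 0) \<in> glue_zero a A W"
      using calculation w signed_spaces_extensional[OF assms(2) w]
      by (auto simp: glue_zero_def PiE_def extensional_def)
    ultimately show "w \<in> (\<lambda>x. restrict x A) ` glue_zero a A W" by (metis image_eqI)
  qed
qed (auto simp: glue_zero_def)

text \<open>The coordinate of \<open>a\<close> is free. Giving it the nonzero value 1 makes the
  signs on \<open>B\<close> visible as the values 1 and -1.\<close>

lemma glue_signed_extension:
  assumes "a \<notin> A" "B \<subseteq> A" "P \<subseteq> B" "W \<in> signed_spaces (A - B)" "w \<in> W"
  defines "u \<equiv> \<lambda>i. if i = a \<or> i \<in> P then 1 else if i \<in> B then - 1 else w i"
  shows "u \<in> glue_signed a A B P W" "restrict u (A - B) = w"
proof -
  have w: "w \<in> (A - B) \<rightarrow>\<^sub>E UNIV"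
    using signed_spaces_extensional assms(4,5) by blast
  show r: "restrict u (A - B) = w"
    using w assms(1-3) by (auto simp: u_def PiE_def extensional_def fun_eq_iff)
  show "u \<in> glue_signed a A B P W"
    unfolding glue_signed_def mem_Collect_eq r using w assms(1-3,5)
    by (auto simp: u_def PiE_def extensional_def)
qed

lemma restrict_glue_signed:
  assumes "a \<notin> A" "B \<subseteq> A" "P \<subseteq> B" "W \<in> signed_spaces (A - B)"
  shows "(\<lambda>x. restrict x (A - B)) ` glue_signed a A B P W = W"
proof
  show "W \<subseteq> (\<lambda>x. restrict x (A - B)) ` glue_signed a A B P W"
  proof
    fix w assume "w \<in> W"
    note ext = glue_signed_extension[OF assms this]
    show "w \<in> (\<lambda>x. restrict x (A - B)) ` glue_signed a A B P W"
      by (rule image_eqI, rule ext(2)[symmetric], rule ext(1))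
  qed
qed (auto simp: glue_signed_def)

text \<open>Extending the zero vector of \<open>W\<close> gives one vector that takes three
  different values on \<open>P\<close>, on \<open>B - P\<close> and on the rest of \<open>A\<close>.
  It therefore refutes every constraint with \<open>a\<close> that is not built into the
  space.\<close>

lemma glue_signed_witness:
  assumes "a \<notin> A" "B \<subseteq> A" "P \<subseteq> B" "W \<in> signed_spaces (A - B)"
  obtains u where "u \<in> glue_signed a A B P W" "u a = 1"
    "\<And>i. i \<in> A \<Longrightarrow> u i = (if i \<in> P then 1 else if i \<in> B then - 1 else 0)"
proof -
  define u :: "'a \<Rightarrow> real" where
    "u i = (if i = a \<or> i \<in> P then 1 else if i \<in> B then - 1 else (\<lambda>i\<in>A - B. 0) i)" for i
  have "u \<in> glue_signed a A B P W"
    unfolding u_def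
    by (rule glue_signed_extension(1)[OF assms zero_in_signed_spaces[OF assms(4)]])
  moreover have "u i = (if i \<in> P then 1 else if i \<in> B then - 1 else 0)" if "i \<in> A" for i
    using that assms(1) by (auto simp: u_def)
  moreover have "u a = 1" by (simp add: u_def)
  ultimately show ?thesis using that by blast
qed

section \<open>Recovering the glued data from the space\<close>

lemma glue_signed_positive_part:
  assumes "a \<notin> A" "B \<subseteq> A" "P \<subseteq> B" "W \<in> signed_spaces (A - B)"
  shows "{i \<in> A. (i, a) \<in> implied_eq (glue_signed a A B P W)} = P"
proof -
  obtain u where u: "u \<in> glue_signed a A B P W" "u a = 1"
    "\<And>i. i \<in> A \<Longrightarrow> u i = (if i \<in> P then 1 else if i \<in> B then - 1 else 0)"
    using glue_signed_witness[OF assms] by blast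
  have "i \<in> P" if "i \<in> A" "(i, a) \<in> implied_eq (glue_signed a A B P W)" for i
  proof -
    have "u i = u a" using that(2) u(1) by (auto simp: implied_eq_def)
    then show ?thesis using u(2) u(3)[OF that(1)] by (simp split: if_splits)
  qed
  moreover have "(i, a) \<in> implied_eq (glue_signed a A B P W)" if "i \<in> P" for i
    using that by (simp add: implied_eq_def glue_signed_def)
  ultimately show ?thesis using assms(2,3) by blast
qed

lemma glue_signed_negative_part:
  assumes "a \<notin> A" "B \<subseteq> A" "P \<subseteq> B" "W \<in> signed_spaces (A - B)"
  shows "{i \<in> A. (i, a) \<in> implied_neg (glue_signed a A B P W)} = B - P"
proof -
  obtain u where u: "u \<in> glue_signed a A B P W" "u a = 1"
    "\<And>i. i \<in> A \<Longrightarrow> u i = (if i \<in> P then 1 else if i \<in> B then - 1 else 0)"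
    using glue_signed_witness[OF assms] by blast
  have "i \<in> B - P" if "i \<in> A" "(i, a) \<in> implied_neg (glue_signed a A B P W)" for i
  proof -
    have "u i = - u a" using that(2) u(1) by (auto simp: implied_neg_def)
    then show ?thesis using u(2) u(3)[OF that(1)] by (simp split: if_splits)
  qed
  moreover have "(i, a) \<in> implied_neg (glue_signed a A B P W)" if "i \<in> B - P" for i
    using that by (simp add: implied_neg_def glue_signed_def)
  ultimately show ?thesis using assms(2,3) by blast
qed

lemma inj_on_glue_zero: "a \<notin> A \<Longrightarrow> inj_on (glue_zero a A) (signed_spaces A)"
  by (rule inj_on_inverseI[where g = "\<lambda>V. (\<lambda>x. restrict x A) ` V"]) (rule restrict_glue_zero)

text \<open>\<open>P\<close> and \<open>B - P\<close> are the coordinates implied to equal that of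
  \<open>a\<close> and its negative, so the space determines \<open>B\<close> and \<open>P\<close>;
  then \<open>W\<close> is its projection to \<open>A - B\<close>.\<close>

lemma inj_on_glue_signed:
  assumes "a \<notin> A"
  shows "inj_on (\<lambda>(B, P, W). glue_signed a A B P W)
    (SIGMA B:Pow A. Pow B \<times> signed_spaces (A - B))"
proof (rule inj_onI, clarsimp)
  fix B P W B' P' W'
  assume *: "B \<subseteq> A" "P \<subseteq> B" "W \<in> signed_spaces (A - B)"
    "B' \<subseteq> A" "P' \<subseteq> B'" "W' \<in> signed_spaces (A - B')"
    and eq: "glue_signed a A B P W = glue_signed a A B' P' W'"
  have P: "P = P'"
    using glue_signed_positive_part[OF assms *(1-3)] glue_signed_positive_part[OF assms *(4-6)]
    unfolding eq by simp
  moreover have "B - P = B' - P'"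
    using glue_signed_negative_part[OF assms *(1-3)] glue_signed_negative_part[OF assms *(4-6)]
    unfolding eq by simp
  ultimately have B: "B = B'" using *(2,5) by blast
  have "W = W'"
    using restrict_glue_signed[OF assms *(1-3)] restrict_glue_signed[OF assms *(4-6)]
    unfolding eq[unfolded B P] B P by simp
  then show "B = B' \<and> P = P' \<and> W = W'" using P B by simp
qed

section \<open>Decomposition along one coordinate\<close>

lemma signed_space_zero_coordinate:
  assumes V: "V \<in> signed_spaces (insert a A)" and zero: "\<And>x. x \<in> V \<Longrightarrow> x a = 0"
  shows "V \<in> glue_zero a A ` signed_spaces A"
proof -
  define W where "W = signed_solutions A (implied_eq V) (implied_neg V)"
  have "V = glue_zero a A W"
  proof
    show "V \<subseteq> glue_zero a A W"
    proof
      fix x assume x: "x \<in> V"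
      have "restrict x A \<in> W"
        using x unfolding W_def restrict_in_signed_solutions implied_eq_def implied_neg_def by blast
      then show "x \<in> glue_zero a A W"
        using signed_spaces_extensional[OF V x] zero[OF x] by (simp add: glue_zero_def)
    qed
    show "glue_zero a A W \<subseteq> V"
    proof
      fix x assume "x \<in> glue_zero a A W"
      then have x: "x \<in> insert a A \<rightarrow>\<^sub>E UNIV" "x a = 0" and "restrict x A \<in> W"
        by (auto simp: glue_zero_def)
      then have xA: "(i, j) \<in> implied_eq V \<Longrightarrow> x i = x j" "(i, j) \<in> implied_neg V \<Longrightarrow> x i = - x j"
        if "i \<in> A" "j \<in> A" for i j
        using that unfolding W_def restrict_in_signed_solutions by blast+
      \<comment> \<open>A coordinate \<open>k\<close> vanishes on \<open>V\<close> exactly when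
        \<open>(k, k)\<close> is in \<open>implied_neg V\<close>, so for \<open>k\<close> in
        \<open>A\<close> this is already a constraint of \<open>W\<close>. It covers the constraints
        involving \<open>a\<close>, since those force both of their coordinates to vanish on
        \<open>V\<close>.\<close>
      have x0: "x k = 0" if "k \<in> insert a A" "\<And>y. y \<in> V \<Longrightarrow> y k = 0" for k
        using xA(2)[of k k] that x(2) by (cases "k = a") (auto simp: implied_neg_def)
      have "x i = x j" if ij: "(i, j) \<in> implied_eq V" "i \<in> insert a A" "j \<in> insert a A" for i j
      proof (cases "i = a \<or> j = a")
        case True
        have "y i = 0 \<and> y j = 0" if y: "y \<in> V" for y
        proof -
          have "y i = y j" using ij(1) y by (simp add: implied_eq_def)
          then show ?thesis using True zero[OF y] by auto
        qed
        then show ?thesis using x0 ij by simp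
      qed (use ij xA in blast)
      moreover have "x i = - x j"
        if ij: "(i, j) \<in> implied_neg V" "i \<in> insert a A" "j \<in> insert a A" for i j
      proof (cases "i = a \<or> j = a")
        case True
        have "y i = 0 \<and> y j = 0" if y: "y \<in> V" for y
        proof -
          have "y i = - y j" using ij(1) y by (simp add: implied_neg_def)
          then show ?thesis using True zero[OF y] by auto
        qed
        then show ?thesis using x0 ij by simp
      qed (use ij xA in blast)
      ultimately have "x \<in> signed_solutions (insert a A) (implied_eq V) (implied_neg V)"
        using x(1) unfolding signed_solutions_def by blast
      then show "x \<in> V" using signed_spaces_implied[OF V] by blast
    qed
  qed
  then show ?thesis unfolding W_def signed_spaces_def by blast
qed

lemma signed_space_nonzero_coordinate:
  assumes V: "V \<in> signed_spaces (insert a A)" and v: "v \<in> V" "v a \<noteq> 0" and a: "a \<notin> A"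
  shows "\<exists>B P W. B \<subseteq> A \<and> P \<subseteq> B \<and> W \<in> signed_spaces (A - B) \<and> V = glue_signed a A B P W"
proof -
  define P where "P = {i \<in> A. (i, a) \<in> implied_eq V}"
  define N where "N = {i \<in> A. (i, a) \<in> implied_neg V}"
  define B where "B = P \<union> N"
  define W where "W = signed_solutions (A - B) (implied_eq V) (implied_neg V)"
  \<comment> \<open>As \<open>v a\<close> is nonzero, \<open>v i\<close> cannot equal both
    \<open>v a\<close> and \<open>- v a\<close>.\<close>
  have disj: "P \<inter> N = {}"
    using v by (fastforce simp: P_def N_def implied_eq_def implied_neg_def)
  have sub: "B \<subseteq> A" "P \<subseteq> B" "B - P = N"
    using disj by (auto simp: B_def P_def N_def)
  \<comment> \<open>Stated for \<open>i = a\<close> as well, where both sides are false, so that the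
    cases below need not treat \<open>a\<close> separately from \<open>P\<close>.\<close>
  have outside_B: "i \<in> A - B \<longleftrightarrow> \<not> (\<forall>y\<in>V. y i = y a) \<and> \<not> (\<forall>y\<in>V. y i = - y a)"
    if "i \<in> insert a A" for i
    using that a by (cases "i = a") (simp_all add: B_def P_def N_def implied_eq_def implied_neg_def)
  have "V = glue_signed a A B P W"
  proof
    show "V \<subseteq> glue_signed a A B P W"
    proof
      fix x assume x: "x \<in> V"
      have "x i = x a" if "i \<in> P" for i using that x by (simp add: P_def implied_eq_def)
      moreover have "x i = - x a" if "i \<in> N" for i using that x by (simp add: N_def implied_neg_def)
      moreover have "restrict x (A - B) \<in> W"
        using x unfolding W_def restrict_in_signed_solutions implied_eq_def implied_neg_def by blast
      ultimately show "x \<in> glue_signed a A B P W"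
        using signed_spaces_extensional[OF V x] unfolding glue_signed_def sub(3) by blast
    qed
    show "glue_signed a A B P W \<subseteq> V"
    proof
      fix x assume "x \<in> glue_signed a A B P W"
      then have x: "x \<in> insert a A \<rightarrow>\<^sub>E UNIV" and P: "\<And>i. i \<in> insert a P \<Longrightarrow> x i = x a"
        and N: "\<And>i. i \<in> N \<Longrightarrow> x i = - x a" and "restrict x (A - B) \<in> W"
        unfolding glue_signed_def sub(3) by blast+
      then have xA: "(i, j) \<in> implied_eq V \<Longrightarrow> x i = x j" "(i, j) \<in> implied_neg V \<Longrightarrow> x i = - x j"
        if "i \<in> A - B" "j \<in> A - B" for i j
        using that unfolding W_def restrict_in_signed_solutions by blast+
      have vP: "v i = v a" if "i \<in> insert a P" for i
        using that v by (auto simp: P_def implied_eq_def)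
      have vN: "v i = - v a" if "i \<in> N" for i
        using that v by (auto simp: N_def implied_neg_def)
      have cases: "i \<in> insert a P \<or> i \<in> N \<or> i \<in> A - B" if "i \<in> insert a A" for i
        using that by (auto simp: B_def)
      \<comment> \<open>An implied constraint cannot link an index in \<open>A - B\<close> to one in
        \<open>insert a B\<close>. If both lie outside \<open>B\<close>, it is a constraint of
        \<open>W\<close>. If both are tied to \<open>a\<close>, comparing \<open>v i\<close> and
        \<open>v j\<close> with \<open>v a\<close>, which is nonzero, decides whether their signs
        agree, and \<open>x\<close> carries the same signs. The negative constraints below are
        treated alike.\<close>
      have "x i = x j" if ij: "(i, j) \<in> implied_eq V" "i \<in> insert a A" "j \<in> insert a A" for i j
      proof -
        have "y i = y a \<longleftrightarrow> y j = y a" "y i = - y a \<longleftrightarrow> y j = - y a" if "y \<in> V" for y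
          using ij(1) that by (auto simp: implied_eq_def)
        then have "i \<in> A - B \<longleftrightarrow> j \<in> A - B"
          unfolding outside_B[OF ij(2)] outside_B[OF ij(3)] by blast
        moreover have "v i = v j" using ij v by (auto simp: implied_eq_def)
        moreover have "x i = x j" if "i \<in> A - B" "j \<in> A - B"
          using that ij(1) xA by blast
        ultimately show ?thesis
          using cases[OF ij(2)] cases[OF ij(3)] P N vP vN v(2) by (smt (verit))
      qed
      moreover have "x i = - x j"
        if ij: "(i, j) \<in> implied_neg V" "i \<in> insert a A" "j \<in> insert a A" for i j
      proof -
        have "y i = y a \<longleftrightarrow> y j = - y a" "y i = - y a \<longleftrightarrow> y j = y a" if "y \<in> V" for y
          using ij(1) that by (auto simp: implied_neg_def)
        then have "i \<in> A - B \<longleftrightarrow> j \<in> A - B"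
          unfolding outside_B[OF ij(2)] outside_B[OF ij(3)] by blast
        moreover have "v i = - v j" using ij v by (auto simp: implied_neg_def)
        moreover have "x i = - x j" if "i \<in> A - B" "j \<in> A - B"
          using that ij(1) xA by blast
        ultimately show ?thesis
          using cases[OF ij(2)] cases[OF ij(3)] P N vP vN v(2) by (smt (verit))
      qed
      ultimately have "x \<in> signed_solutions (insert a A) (implied_eq V) (implied_neg V)"
        using x unfolding signed_solutions_def by blast
      then show "x \<in> V" using signed_spaces_implied[OF V] by blast
    qed
  qed
  moreover have "W \<in> signed_spaces (A - B)" unfolding W_def signed_spaces_def by blast
  ultimately show ?thesis using sub by blast
qed

lemma signed_spaces_insert:
  assumes "a \<notin> A"
  shows "signed_spaces (insert a A) = glue_zero a A ` signed_spaces A \<union>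
    (\<lambda>(B, P, W). glue_signed a A B P W) ` (SIGMA B:Pow A. Pow B \<times> signed_spaces (A - B))"
    (is "?L = ?Z \<union> ?f ` ?S" is "_ = _ \<union> ?N")
proof
  have "glue_signed a A B P W \<in> ?L" if "(B, P, W) \<in> ?S" for B P W
    using that by (intro glue_signed_in_signed_spaces) simp_all
  then have "?N \<subseteq> ?L" by (intro image_subsetI) (simp only: split_paired_all prod.case)
  moreover have "?Z \<subseteq> ?L"
    using glue_zero_in_signed_spaces by (intro image_subsetI)
  ultimately show "?Z \<union> ?N \<subseteq> ?L" by (rule Un_least[rotated])
  show "?L \<subseteq> ?Z \<union> ?N"
  proof
    fix V assume V: "V \<in> ?L"
    show "V \<in> ?Z \<union> ?N"
    proof (cases "\<forall>x\<in>V. x a = 0")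
      case True
      then show ?thesis using signed_space_zero_coordinate[OF V] by blast
    next
      case False
      then obtain v where "v \<in> V" "v a \<noteq> 0" by blast
      from signed_space_nonzero_coordinate[OF V this assms] obtain B P W
        where BPW: "B \<subseteq> A" "P \<subseteq> B" "W \<in> signed_spaces (A - B)" and eq: "V = glue_signed a A B P W"
        by blast
      have "(B, P, W) \<in> ?S" using BPW by simp
      then have "V \<in> ?N" by (rule rev_image_eqI) (simp add: eq)
      then show ?thesis by (rule UnI2)
    qed
  qed
qed

text \<open>The witness vector has value 1 at \<open>a\<close>, whereas every vector of a space
  glued with zero has value 0 there.\<close>

lemma glue_zero_glue_signed_disjoint:
  assumes "a \<notin> A"
  shows "glue_zero a A ` signed_spaces A \<inter>
    (\<lambda>(B, P, W). glue_signed a A B P W) ` (SIGMA B:Pow A. Pow B \<times> signed_spaces (A - B)) = {}"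
proof -
  have False if glue: "B \<subseteq> A" "P \<subseteq> B" "W \<in> signed_spaces (A - B)"
    "glue_zero a A W' = glue_signed a A B P W" for B P W W'
  proof -
    obtain u where u: "u \<in> glue_signed a A B P W" "u a = 1"
      using glue_signed_witness[OF assms glue(1-3)] by blast
    have "u a = 0" using u(1) unfolding glue(4)[symmetric] glue_zero_def by blast
    then show False using u(2) by simp
  qed
  then show ?thesis by (intro equals0I) (elim IntE imageE SigmaE, simp, blast)
qed

section \<open>Finiteness and the recursion for the count\<close>

text \<open>Induction over proper subsets, because splitting off \<open>a\<close> together with
  \<open>B\<close> leaves an arbitrary smaller index set. Finiteness is what makes cardinalities
  additive in the recursion.\<close>

lemma finite_signed_spaces: "finite A \<Longrightarrow> finite (signed_spaces A)"
proof (induction A rule: finite_psubset_induct)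
  case (psubset A)
  show ?case
  proof (cases "A = {}")
    case True
    then show ?thesis by (simp add: signed_spaces_empty)
  next
    case False
    then obtain a C where A: "A = insert a C" "a \<notin> C" by (meson mk_disjoint_insert ex_in_conv)
    have C: "finite (signed_spaces (C - B))" for B
      using psubset.IH[of "C - B"] A by blast
    have fin: "finite C" using psubset.hyps A by simp
    then have prod: "finite (Pow B \<times> signed_spaces (C - B))" if "B \<in> Pow C" for B
      using that finite_subset[of B C] C[of B] by simp
    have "finite (SIGMA B:Pow C. Pow B \<times> signed_spaces (C - B))"
      by (rule finite_SigmaI[OF finite_Pow_iff[THEN iffD2, OF fin] prod])
    then show ?thesis
      unfolding A(1) signed_spaces_insert[OF A(2)] using C[of "{}"] by simp
  qed
qed

lemma card_signed_spaces_insert: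
  assumes "finite A" "a \<notin> A"
  shows "card (signed_spaces (insert a A)) =
    card (signed_spaces A) + (\<Sum>B\<in>Pow A. 2 ^ card B * card (signed_spaces (A - B)))"
proof -
  let ?S = "SIGMA B:Pow A. Pow B \<times> signed_spaces (A - B)"
  have fin: "finite (Pow B \<times> signed_spaces (A - B))" if "B \<in> Pow A" for B
    using that assms(1) finite_signed_spaces[of "A - B"] finite_subset[of B A] by simp
  have S: "finite ?S"
    by (rule finite_SigmaI[OF finite_Pow_iff[THEN iffD2, OF assms(1)] fin])
  have "card ?S = (\<Sum>B\<in>Pow A. card (Pow B \<times> signed_spaces (A - B)))"
    by (rule card_SigmaI) (use assms(1) fin in blast)+
  also have "\<dots> = (\<Sum>B\<in>Pow A. 2 ^ card B * card (signed_spaces (A - B)))"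
    using finite_subset[OF _ assms(1)]
    by (intro sum.cong) (simp_all add: card_cartesian_product card_Pow)
  finally have card_S: "card ?S = \<dots>" .
  show ?thesis
    unfolding signed_spaces_insert[OF assms(2)] card_S[symmetric]
    using glue_zero_glue_signed_disjoint[OF assms(2)] S finite_signed_spaces[OF assms(1)]
    by (simp add: card_Un_disjoint card_image inj_on_glue_zero inj_on_glue_signed assms(2))
qed

lemma sum_Pow_card:
  fixes f :: "nat \<Rightarrow> 'b::comm_semiring_1"
  assumes "finite A"
  shows "(\<Sum>B\<in>Pow A. f (card B)) = (\<Sum>k\<le>card A. of_nat (card A choose k) * f k)"
proof -
  have "(\<Sum>B\<in>Pow A. f (card B)) = (\<Sum>k\<le>card A. \<Sum>B\<in>{B \<in> Pow A. card B = k}. f (card B))"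
    using assms by (intro sum.group[symmetric]) (auto intro: card_mono)
  also have "\<dots> = (\<Sum>k\<le>card A. of_nat (card A choose k) * f k)"
    using n_subsets[OF assms] by (intro sum.cong) (auto simp: Pow_def)
  finally show ?thesis .
qed

section \<open>The exponential generating function\<close>

unbundle fps_syntax

text \<open>Read coefficientwise, the differential equation is the recursion of
  \<open>card_signed_spaces_insert\<close>, and the initial value is the single space on the empty
  index set. Induction thus identifies the counts with the coefficients of any solution
  \<open>G\<close>.\<close>

lemma card_signed_spaces:
  fixes G :: "real fps"
  assumes G0: "G $ 0 = 1" and G': "fps_deriv G = (1 + fps_exp 2) * G"
  shows "finite A \<Longrightarrow> real (card (signed_spaces A)) = fact (card A) * G $ card A"
proof (induction A rule: finite_psubset_induct)
  case (psubset A)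
  show ?case
  proof (cases "A = {}")
    case True
    then show ?thesis by (simp add: signed_spaces_empty G0)
  next
    case False
    then obtain a C where A: "A = insert a C" "a \<notin> C" by (meson mk_disjoint_insert ex_in_conv)
    have fin: "finite C" using psubset.hyps A by simp
    let ?n = "card C"
    have IH: "real (card (signed_spaces (C - B))) = fact (?n - card B) * G $ (?n - card B)"
      if "B \<subseteq> C" for B
    proof -
      have "C - B \<subset> A" using A by blast
      then show ?thesis
        using psubset.IH[of "C - B"] that fin by (simp add: card_Diff_subset finite_subset)
    qed
    have "real (card (signed_spaces A)) = real (card (signed_spaces C)) +
        (\<Sum>B\<in>Pow C. 2 ^ card B * real (card (signed_spaces (C - B))))"
      unfolding A(1) card_signed_spaces_insert[OF fin A(2)] by simp
    also have "\<dots> = fact ?n * G $ ?n +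
        (\<Sum>B\<in>Pow C. 2 ^ card B * (fact (?n - card B) * G $ (?n - card B)))"
      using IH IH[of "{}"] by simp
    also have "\<dots> = fact ?n * G $ ?n +
        (\<Sum>k\<le>?n. real (?n choose k) * (2 ^ k * (fact (?n - k) * G $ (?n - k))))"
      by (subst sum_Pow_card[OF fin]) simp
    \<comment> \<open>Since \<open>(n choose k) * fact (n - k) = fact n / fact k\<close>, the sum
      becomes the Cauchy product of \<open>G\<close> with \<open>fps_exp 2\<close>, whose
      coefficients are \<open>2 ^ k / fact k\<close>.\<close>
    also have "\<dots> = fact ?n * (G $ ?n + (\<Sum>k\<le>?n. 2 ^ k / fact k * G $ (?n - k)))"
      by (simp add: distrib_left sum_distrib_left binomial_fact)
    also have "\<dots> = fact ?n * fps_deriv G $ ?n"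
      unfolding G' by (simp add: distrib_right fps_mult_nth atLeast0AtMost)
    \<comment> \<open>Here \<open>card A = card C + 1\<close>; the factor \<open>card C + 1\<close>
      produced by the derivative completes the factorial.\<close>
    also have "\<dots> = fact (card A) * G $ card A"
      using A fin by simp
    finally show ?thesis .
  qed
qed

theorem proposition7p19:
  "Abs_fps (\<lambda>n. real (num_polydiagonal_subspaces n) / fact n) =
     fps_exp (1::real) oo (fps_const (1/2) * (fps_exp 2 - 1 + fps_const 2 * fps_X))"
proof -
  define H :: "real fps" where "H = fps_const (1/2) * (fps_exp 2 - 1 + fps_const 2 * fps_X)"
  define G where "G = fps_exp 1 oo H"
  \<comment> \<open>The vanishing constant term is what licenses the chain rule for the composition;
    with the derivative of \<open>H\<close> equal to \<open>1 + fps_exp 2\<close> it yields the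
    required differential equation for \<open>G\<close>.\<close>
  have H0: "H $ 0 = 0" by (simp add: H_def)
  have H': "fps_deriv H = 1 + fps_exp 2"
    by (rule fps_ext) (simp add: H_def)
  have "G $ 0 = 1" by (simp add: G_def)
  moreover have "fps_deriv G = (1 + fps_exp 2) * G"
    by (simp add: G_def fps_compose_deriv H0 H' mult.commute)
  ultimately have "real (card (signed_spaces {1..n})) = fact n * G $ n" for n :: nat
    using card_signed_spaces[of G "{1..n}"] by simp
  then have "Abs_fps (\<lambda>n. real (num_polydiagonal_subspaces n) / fact n) = G"
    by (intro fps_ext) (simp add: num_polydiagonal_subspaces_def polydiagonal_subspace_iff)
  then show ?thesis by (simp add: G_def H_def)
qed

end
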